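(* Let $p,q\ge 1$ be coprime and consider the annulus with $q$ marked points $0,1,\ldots,q-1$ on the bottom boundary and $p$ marked points $q,q+1,\ldots,q+p-1$ on the top boundary, with the initial triangulation of the $\tilde A_{q,p}$ cluster algebra. If $q\geq 2$, then for $j=0,1,\ldots,q-1$ the arc on the bottom boundary joining $j$ to $j+2$ by jumping over the single vertex $j+1$ is the arc associated with the periodic quantity $J_{jp}$. If $p\ge 2$, then for $i=0,1,\ldots,p-1$ the arc on the top boundary joining $q+i$ to $q+i-2$ by jumping over the single vertex $q+i-1$ is the arc associated with the periodic quantity $\tilde J_{-iq}$. In particular these periodic quantities are cluster variables.
   Context: Let $N=p+q$. The quiver $\tilde A_{q,p}$ has vertices $0,\ldots,N-1$; its underlying graph is the cycle with consecutive vertices $0,p,2p,\ldots,(N-1)p$ modulo $N$, each edge oriented from smaller to larger label. The initial cluster variables are $x_0,\ldots,x_{N-1}$, extended to $(x_n)_{n\in\mathbb Z}$ by $x_{n+p+q}x_n=x_{n+q}x_{n+p}+1$. The periodic quantities are $$J_n:=\frac{x_{n+2p}+x_n}{x_{n+p}},\qquad\tilde J_n:=\frac{x_{n+2q}+x_n}{x_{n+q}},$$ with $J_{n+q}=J_n$, $\tilde J_{n+p}=\tilde J_n$. The annulus is the quotient of an infinite strip, with bottom marked points $v_j$ and top marked points $v'_i$ ($i,j\in\mathbb Z$, ordered left to right), by the translation $v_j\mapsto v_{j+q}$, $v'_i\mapsto v'_{i+p}$. The bottom vertex called $j$ is the class of $v_j$ and the top vertex called $q+i$ is the class of $v'_i$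 (so bottom labels are cyclic modulo $q$ and the index $i$ of top labels $q+i$ is cyclic modulo $p$). An arc jumping over a vertex is the image of a curve in the strip, isotopic to the corresponding part of the boundary line, e.g. from $v_j$ to $v_{j+2}$. The initial triangulation consists of the arcs from $v_{k-\lfloor kp/N\rfloor}$ to $v'_{\lfloor kp/N\rfloor}$, $k=0,\ldots,N-1$; the $k$-th arc carries the initial variable $x_{kp \bmod N}$. Flipping an arc $k$ of a triangulation replaces it by the other diagonal $k'$ of its quadrilateral, and the variable of the new arc is given by $x_kx_{k'}=x_ax_c+x_bx_d$, where $a,b,c,d$ are the sides in cyclic order and boundary segments have value $1$. This associates a cluster variable to each arc. *)

theory Defs
  imports Complex_Main
begin

section \<open>Cluster algebras of quivers\<close>

text \<open>Algebraic independence over the rationals of \<open>x 0, \<dots>, x (N - 1)\<close>. A monomial is given by its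
  exponent function; exponents at indices \<open>\<ge> N\<close> are forced to be zero so that distinct
  functions are distinct monomials. Integer coefficients suffice by clearing denominators.\<close>

definition alg_indep :: "nat \<Rightarrow> (nat \<Rightarrow> 'a::field_char_0) \<Rightarrow> bool" where
  "alg_indep N x \<longleftrightarrow>
    (\<forall>(M :: (nat \<Rightarrow> nat) set) (c :: (nat \<Rightarrow> nat) \<Rightarrow> int).
       finite M \<longrightarrow> (\<forall>m\<in>M. \<forall>i\<ge>N. m i = 0) \<longrightarrow>
       (\<Sum>m\<in>M. of_int (c m) * (\<Prod>i<N. x i ^ m i)) = 0 \<longrightarrow> (\<forall>m\<in>M. c m = 0))"

text \<open>A quiver without loops and 2-cycles on \<open>{..<N}\<close> is encoded by its skew-symmetric matrix
  \<open>B i j = #(arrows i \<rightarrow> j) - #(arrows j \<rightarrow> i)\<close>. A seed is such a matrix with a cluster.\<close>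

type_synonym 'a seed = "(nat \<Rightarrow> nat \<Rightarrow> int) \<times> (nat \<Rightarrow> 'a)"

definition mutate_quiver :: "nat \<Rightarrow> (nat \<Rightarrow> nat \<Rightarrow> int) \<Rightarrow> nat \<Rightarrow> nat \<Rightarrow> int" where
  "mutate_quiver k B = (\<lambda>i j. if i = k \<or> j = k then - B i j
     else B i j + max 0 (B i k) * max 0 (B k j) - max 0 (- B i k) * max 0 (- B k j))"

definition mutate_cluster ::
    "nat \<Rightarrow> nat \<Rightarrow> (nat \<Rightarrow> nat \<Rightarrow> int) \<Rightarrow> (nat \<Rightarrow> 'a::field) \<Rightarrow> nat \<Rightarrow> 'a" where
  "mutate_cluster N k B y = y(k :=
     ((\<Prod>i<N. y i ^ nat (B i k)) + (\<Prod>i<N. y i ^ nat (- B i k))) / y k)"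

inductive mutation_reachable :: "nat \<Rightarrow> 'a::field seed \<Rightarrow> 'a seed \<Rightarrow> bool"
  for N :: nat and S :: "'a seed" where
  "mutation_reachable N S S"
| "mutation_reachable N S (B, y) \<Longrightarrow> k < N \<Longrightarrow>
     mutation_reachable N S (mutate_quiver k B, mutate_cluster N k B y)"

definition cluster_variables :: "nat \<Rightarrow> (nat \<Rightarrow> nat \<Rightarrow> int) \<Rightarrow> (nat \<Rightarrow> 'a::field) \<Rightarrow> 'a set" where
  "cluster_variables N B x = {y k | B' y k. mutation_reachable N (B, x) (B', y) \<and> k < N}"

section \<open>The quiver of type \<open>\<tilde>A\<^sub>q\<^sub>,\<^sub>p\<close> and the periodic quantities\<close>

text \<open>The \<open>k\<close>-th edge of the cycle joins \<open>kp mod N\<close> to \<open>(k + 1)p mod N\<close>. Edges are counted with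
  multiplicity: for \<open>p = q = 1\<close> this is the Kronecker quiver.\<close>

definition num_arrows :: "nat \<Rightarrow> nat \<Rightarrow> nat \<Rightarrow> nat \<Rightarrow> nat" where
  "num_arrows p q i j = card {k. k < p + q \<and> i < j \<and>
     {i, j} = {k * p mod (p + q), (k + 1) * p mod (p + q)}}"

definition quiver_A :: "nat \<Rightarrow> nat \<Rightarrow> nat \<Rightarrow> nat \<Rightarrow> int" where
  "quiver_A p q i j = int (num_arrows p q i j) - int (num_arrows p q j i)"

text \<open>The extension of \<open>x 0, \<dots>, x (p + q - 1)\<close> to integer indices, i.e. the recurrence
  \<open>x\<^sub>n\<^sub>+\<^sub>p\<^sub>+\<^sub>q x\<^sub>n = x\<^sub>n\<^sub>+\<^sub>q x\<^sub>n\<^sub>+\<^sub>p + 1\<close> solved for its last or its first term.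
  The case \<open>p = 0 \<or> q = 0\<close> is only there to make the recursion terminate.\<close>

function xseq :: "nat \<Rightarrow> nat \<Rightarrow> (nat \<Rightarrow> 'a::field) \<Rightarrow> int \<Rightarrow> 'a" where
  "xseq p q x n =
    (if p = 0 \<or> q = 0 then 0
     else if n < 0 then
       (xseq p q x (n + int q) * xseq p q x (n + int p) + 1) / xseq p q x (n + int p + int q)
     else if n < int p + int q then x (nat n)
     else (xseq p q x (n - int p) * xseq p q x (n - int q) + 1) / xseq p q x (n - int p - int q))"
  by pat_completeness auto
termination
  by (relation "measure (\<lambda>(p, q, x, n).
        if n < 0 then nat (- n) else if n < int p + int q then 0 else nat n)") auto

declare xseq.simps [simp del]

definition periodic_J :: "nat \<Rightarrow> nat \<Rightarrow> (nat \<Rightarrow> 'a::field) \<Rightarrow> int \<Rightarrow> 'a" where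
  "periodic_J p q x n =
     (xseq p q x (n + 2 * int p) + xseq p q x n) / xseq p q x (n + int p)"

definition periodic_Jt :: "nat \<Rightarrow> nat \<Rightarrow> (nat \<Rightarrow> 'a::field) \<Rightarrow> int \<Rightarrow> 'a" where
  "periodic_Jt p q x n =
     (xseq p q x (n + 2 * int q) + xseq p q x n) / xseq p q x (n + int q)"

section \<open>Arcs and triangulations of the annulus\<close>

text \<open>\<open>Bot j\<close> and \<open>Top i\<close> are the marked points \<open>v\<^sub>j\<close> and \<open>v'\<^sub>i\<close> of the strip. The vertices of the annulus
  called \<open>j\<close> and \<open>q + i\<close> are the classes of \<open>Bot j\<close> and \<open>Top i\<close> under \<open>shift p q\<close>.\<close>

datatype point = Bot int | Top int

fun shift :: "nat \<Rightarrow> nat \<Rightarrow> int \<Rightarrow> point \<Rightarrow> point" where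
  "shift p q m (Bot j) = Bot (j + m * int q)"
| "shift p q m (Top i) = Top (i + m * int p)"

text \<open>The counterclockwise cyclic order of the boundary points of the strip (bottom line from left to
  right, then top line from right to left), cut open at the left end of the strip.\<close>

fun before :: "point \<Rightarrow> point \<Rightarrow> bool" where
  "before (Bot j) (Bot k) \<longleftrightarrow> j < k"
| "before (Bot _) (Top _) \<longleftrightarrow> True"
| "before (Top _) (Bot _) \<longleftrightarrow> False"
| "before (Top i) (Top k) \<longleftrightarrow> k < i"

definition increasing4 :: "point \<Rightarrow> point \<Rightarrow> point \<Rightarrow> point \<Rightarrow> bool" where
  "increasing4 A B C D \<longleftrightarrow> before A B \<and> before B C \<and> before C D"

definition cyclic4 :: "point \<Rightarrow> point \<Rightarrow> point \<Rightarrow> point \<Rightarrow> bool" where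
  "cyclic4 A B C D \<longleftrightarrow>
     increasing4 A B C D \<or> increasing4 B C D A \<or> increasing4 C D A B \<or> increasing4 D A B C"

text \<open>The strip is simply connected, so up to isotopy a curve in it is determined by its two end
  points. A curve in the annulus is represented by the set of all its lifts to the strip.\<close>

type_synonym arc = "point set set"

definition arc :: "nat \<Rightarrow> nat \<Rightarrow> point \<Rightarrow> point \<Rightarrow> arc" where
  "arc p q P Q = {{shift p q m P, shift p q m Q} | m. True}"

definition boundary_segment :: "nat \<Rightarrow> nat \<Rightarrow> arc \<Rightarrow> bool" where
  "boundary_segment p q g \<longleftrightarrow>
     (\<exists>j. g = arc p q (Bot j) (Bot (j + 1))) \<or> (\<exists>i. g = arc p q (Top i) (Top (i + 1)))"

text \<open>A triangulation with variables is a partial map whose domain is the set of arcs of the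
  triangulation and which sends each arc to its variable.\<close>

definition side_value :: "nat \<Rightarrow> nat \<Rightarrow> (arc \<rightharpoonup> 'a::field) \<Rightarrow> arc \<Rightarrow> 'a option" where
  "side_value p q T g = (if boundary_segment p q g then Some 1 else T g)"

definition initial_triangulation :: "nat \<Rightarrow> nat \<Rightarrow> (nat \<Rightarrow> 'a::field) \<Rightarrow> (arc \<rightharpoonup> 'a)" where
  "initial_triangulation p q x = map_of (map (\<lambda>k.
     (arc p q (Bot (int (k - k * p div (p + q)))) (Top (int (k * p div (p + q)))),
      x (k * p mod (p + q)))) [0..<p + q])"

text \<open>The diagonal \<open>AC\<close> of the quadrilateral \<open>ABCD\<close> (a lift to the strip of the quadrilateral in the
  annulus) is replaced by \<open>BD\<close>.\<close>

inductive flip :: "nat \<Rightarrow> nat \<Rightarrow> (arc \<rightharpoonup> 'a::field) \<Rightarrow> (arc \<rightharpoonup> 'a) \<Rightarrow> bool"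
  for p q :: nat where
  "cyclic4 A B C D \<Longrightarrow> T (arc p q A C) = Some k \<Longrightarrow>
   side_value p q T (arc p q A B) = Some a \<Longrightarrow> side_value p q T (arc p q B C) = Some b \<Longrightarrow>
   side_value p q T (arc p q C D) = Some c \<Longrightarrow> side_value p q T (arc p q D A) = Some d \<Longrightarrow>
   flip p q T (T(arc p q A C := None, arc p q B D := Some ((a * c + b * d) / k)))"

text \<open>All values that some sequence of flips from the initial triangulation gives to an arc. The arc \<open>g\<close>
  has the associated variable \<open>f\<close> iff this set is \<open>{f}\<close>, i.e. \<open>g\<close> occurs in some triangulation
  obtained by flips, and it carries \<open>f\<close> whenever it occurs.\<close>

definition arc_values :: "nat \<Rightarrow> nat \<Rightarrow> (nat \<Rightarrow> 'a::field) \<Rightarrow> arc \<Rightarrow> 'a set" where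
  "arc_values p q x g = {f. \<exists>T. (flip p q)\<^sup>*\<^sup>* (initial_triangulation p q x) T \<and> T g = Some f}"

definition arc_variable :: "nat \<Rightarrow> nat \<Rightarrow> (nat \<Rightarrow> 'a::field) \<Rightarrow> arc \<Rightarrow> 'a \<Rightarrow> bool" where
  "arc_variable p q x g f \<longleftrightarrow> arc_values p q x g = {f}"

end

theory Submission
  imports Defs
begin

text \<open>The recurrence says that \<open>(j, i) \<mapsto> x\<^bsub>jp - iq\<^esub>\<close> is an \<open>SL\<^sub>2\<close>-tiling. Such a tiling has rank 2, so one
  can attach to each marked point \<open>P\<close> of the strip a vector \<open>vec P\<close> with
  \<open>det (vec v\<^sub>j, vec v'\<^sub>i) = x\<^bsub>jp - iq\<^esub>\<close> and such that consecutive boundary points have determinant 1. These determinants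
  satisfy the Ptolemy relation, hence flips preserve the property that each arc carries its determinant.
  No division by zero occurs since all determinants are subtraction-free in the initial variables.

  Let the height of the arc from \<open>v\<^sub>j\<close> to \<open>v'\<^sub>i\<close> be \<open>jp - iq\<close>. The initial triangulation has heights
  \<open>0, \<dots>, N - 1\<close>. If \<open>n\<close>, \<open>n - p\<close> and \<open>n - q\<close> are heights, then the arc of height \<open>n\<close> can be flipped to the one of
  height \<open>n - N\<close>; on the quiver this is a mutation at a sink. For \<open>c < q\<close>, do this for all
  \<open>n \<equiv> c (mod q)\<close> with \<open>n \<noteq> c\<close>, from the largest down. Afterwards \<open>c - p\<close>, \<open>c\<close> and \<open>c + p\<close> are heights, and the
  flip (mutation) at \<open>c\<close> gives the arc jumping over a bottom vertex, with the variable
  \<open>(x\<^bsub>c+p\<^esub> + x\<^bsub>c-p\<^esub>) / x\<^sub>c = J\<^bsub>c-p\<^esub>\<close>. The top boundary is the same with \<open>p\<close> and \<open>q\<close> exchanged.\<close>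

section \<open>Subtraction-free expressions\<close>

definition monomial :: "nat \<Rightarrow> (nat \<Rightarrow> 'a::field_char_0) \<Rightarrow> (nat \<Rightarrow> nat) \<Rightarrow> 'a" where
  "monomial N x m = (\<Prod>i<N. x i ^ m i)"

lemma monomial_add: "monomial N x (\<lambda>i. m i + m' i) = monomial N x m * monomial N x m'"
  by (simp add: monomial_def power_add prod.distrib)

text \<open>A list lets monomials repeat, so coefficients are implicit and positive, and sums are
  concatenations. Nonemptiness excludes 0.\<close>

definition pos_poly :: "nat \<Rightarrow> (nat \<Rightarrow> 'a::field_char_0) \<Rightarrow> 'a set" where
  "pos_poly N x = {sum_list (map (monomial N x) ms) | ms. ms \<noteq> [] \<and> (\<forall>m\<in>set ms. \<forall>i\<ge>N. m i = 0)}"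

lemma pos_poly_var: assumes "i < N" shows "x i \<in> pos_poly N x"
proof -
  let ?m = "\<lambda>j. if j = i then 1 else 0 :: nat"
  have "monomial N x ?m = (\<Prod>j<N. if j = i then x j else 1)"
    unfolding monomial_def by (rule prod.cong) auto
  also have "\<dots> = x i"
    using assms by (simp add: prod.delta)
  finally show ?thesis
    unfolding pos_poly_def using assms by (intro CollectI exI[of _ "[?m]"]) auto
qed

lemma pos_poly_one: "1 \<in> pos_poly N x"
  unfolding pos_poly_def by (intro CollectI exI[of _ "[\<lambda>_. 0]"]) (auto simp: monomial_def)

lemma pos_poly_add:
  assumes "f \<in> pos_poly N x" "g \<in> pos_poly N x"
  shows "f + g \<in> pos_poly N x"
proof -
  obtain ms ms' where
    "f = sum_list (map (monomial N x) ms)" "ms \<noteq> []" "\<forall>m\<in>set ms. \<forall>i\<ge>N. m i = 0"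
    "g = sum_list (map (monomial N x) ms')" "\<forall>m\<in>set ms'. \<forall>i\<ge>N. m i = 0"
    using assms unfolding pos_poly_def by auto
  then show ?thesis
    unfolding pos_poly_def by (intro CollectI exI[of _ "ms @ ms'"]) auto
qed

lemma pos_poly_mult:
  assumes "f \<in> pos_poly N x" "g \<in> pos_poly N x"
  shows "f * g \<in> pos_poly N x"
proof -
  obtain ms ms' where ms:
    "f = sum_list (map (monomial N x) ms)" "ms \<noteq> []" "\<forall>m\<in>set ms. \<forall>i\<ge>N. m i = 0"
    "g = sum_list (map (monomial N x) ms')" "ms' \<noteq> []" "\<forall>m\<in>set ms'. \<forall>i\<ge>N. m i = 0"
    using assms unfolding pos_poly_def by auto
  define ns where "ns = concat (map (\<lambda>m. map (\<lambda>m' i. m i + m' i) ms') ms)"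
  have "sum_list (map (monomial N x) ns) = f * g"
    unfolding ns_def ms
    by (induction ms) (simp_all add: o_def monomial_add sum_list_const_mult distrib_right)
  moreover have "ns \<noteq> []"
    using ms(2,5) by (auto simp: ns_def neq_Nil_conv)
  moreover have "\<forall>m\<in>set ns. \<forall>i\<ge>N. m i = 0"
    using ms(3,6) by (auto simp: ns_def)
  ultimately show ?thesis
    unfolding pos_poly_def by (intro CollectI exI[of _ ns]) auto
qed

text \<open>Collects equal monomials, with multiplicities as coefficients: the shape to which
  \<open>alg_indep\<close> applies.\<close>

lemma sum_list_map_count:
  fixes f :: "'b \<Rightarrow> 'a::comm_semiring_1"
  shows "sum_list (map f xs) = (\<Sum>y\<in>set xs. of_nat (count_list xs y) * f y)"
proof (induction xs)
  case (Cons a xs)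
  have "(\<Sum>y\<in>set (a # xs). of_nat (count_list (a # xs) y) * f y) =
      (\<Sum>y\<in>set (a # xs). (if y = a then f y else 0) + of_nat (count_list xs y) * f y)"
    by (rule sum.cong) (auto simp: algebra_simps)
  also have "\<dots> = f a + (\<Sum>y\<in>set (a # xs). of_nat (count_list xs y) * f y)"
    by (simp add: sum.distrib sum.delta)
  also have "(\<Sum>y\<in>set (a # xs). of_nat (count_list xs y) * f y) =
      (\<Sum>y\<in>set xs. of_nat (count_list xs y) * f y)"
    by (rule sum.mono_neutral_right) (auto simp: count_list_0_iff)
  finally show ?case
    using Cons by simp
qed simp

text \<open>Positive multiplicities cannot cancel: independence would force all of them to be 0,
  although the list has a member.\<close>

lemma pos_poly_nonzero:
  assumes "alg_indep N x" "f \<in> pos_poly N x"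
  shows "f \<noteq> 0"
proof
  assume "f = 0"
  obtain ms where ms: "f = sum_list (map (monomial N x) ms)" "ms \<noteq> []"
      "\<forall>m\<in>set ms. \<forall>i\<ge>N. m i = 0"
    using assms(2) unfolding pos_poly_def by auto
  have "(\<Sum>m\<in>set ms. of_int (int (count_list ms m)) * (\<Prod>i<N. x i ^ m i)) = 0"
    using ms(1) \<open>f = 0\<close> by (simp add: sum_list_map_count monomial_def)
  then have "\<forall>m\<in>set ms. int (count_list ms m) = 0"
    using assms(1) ms(3) unfolding alg_indep_def
    by (elim allE[where x = "set ms"] allE[where x = "\<lambda>m. int (count_list ms m)"]) auto
  with ms(2) show False
    by (metis count_list_0_iff int_eq_iff of_nat_0 list.set_sel(1))
qed

definition pos_rat :: "nat \<Rightarrow> (nat \<Rightarrow> 'a::field_char_0) \<Rightarrow> 'a set" where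
  "pos_rat N x = {f / g | f g. f \<in> pos_poly N x \<and> g \<in> pos_poly N x}"

lemma pos_poly_subset_pos_rat: "pos_poly N x \<subseteq> pos_rat N x"
  unfolding pos_rat_def using pos_poly_one by force

lemma pos_rat_nonzero: "alg_indep N x \<Longrightarrow> f \<in> pos_rat N x \<Longrightarrow> f \<noteq> 0"
  unfolding pos_rat_def by (auto dest: pos_poly_nonzero)

lemma pos_rat_add:
  assumes "alg_indep N x" "f \<in> pos_rat N x" "g \<in> pos_rat N x"
  shows "f + g \<in> pos_rat N x"
proof -
  obtain a b c d where *: "f = a / b" "g = c / d"
      "a \<in> pos_poly N x" "b \<in> pos_poly N x" "c \<in> pos_poly N x" "d \<in> pos_poly N x"
    using assms(2,3) unfolding pos_rat_def by auto
  then have "b \<noteq> 0" "d \<noteq> 0"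
    using pos_poly_nonzero[OF assms(1)] by blast+
  then have "f + g = (a * d + c * b) / (b * d)"
    unfolding * by (simp add: field_simps)
  then show ?thesis
    unfolding pos_rat_def using * by (auto intro!: pos_poly_add pos_poly_mult)
qed

lemma pos_rat_mult:
  assumes "f \<in> pos_rat N x" "g \<in> pos_rat N x"
  shows "f * g \<in> pos_rat N x"
  using assms unfolding pos_rat_def by (fastforce simp: times_divide_times_eq intro: pos_poly_mult)

lemma pos_rat_divide:
  assumes "f \<in> pos_rat N x" "g \<in> pos_rat N x"
  shows "f / g \<in> pos_rat N x"
  using assms unfolding pos_rat_def by (fastforce simp: divide_divide_times_eq intro: pos_poly_mult)

lemma pos_rat_one: "1 \<in> pos_rat N x"
  using pos_poly_one pos_poly_subset_pos_rat by blast

text \<open>Besides the variables, the recursion uses only 1, sums, products and quotients, all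
  available in \<open>pos_rat\<close>.\<close>

lemma xseq_pos_rat:
  assumes "p \<ge> 1" "q \<ge> 1" "alg_indep (p + q) x"
  shows "xseq p q x n \<in> pos_rat (p + q) x"
  using assms
proof (induction p q x n rule: xseq.induct)
  case (1 p q x n)
  note [intro] = pos_rat_divide pos_rat_add pos_rat_mult pos_rat_one
  consider "n < 0" | "0 \<le> n" "n < int p + int q" | "int p + int q \<le> n"
    by linarith
  then show ?case
  proof cases
    case 2
    then have "nat n < p + q" by linarith
    then have "x (nat n) \<in> pos_rat (p + q) x"
      using pos_poly_var pos_poly_subset_pos_rat by blast
    with 2 1 show ?thesis by (subst xseq.simps) simp
  next
    case 1
    with "1.prems" "1.IH"(1-3) show ?thesis by (subst xseq.simps) auto
  next
    case 3
    with "1.prems" "1.IH"(4-6) show ?thesis by (subst xseq.simps) auto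
  qed
qed

section \<open>Arcs\<close>

lemma arc_commute: "arc p q P Q = arc p q Q P"
  unfolding arc_def by (simp add: insert_commute)

lemma shift_zero [simp]: "shift p q 0 P = P"
  by (cases P) auto

lemma shift_shift: "shift p q m (shift p q m' P) = shift p q (m + m') P"
  by (cases P) (auto simp: algebra_simps)

lemma arc_eq_shift:
  assumes "arc p q P Q = arc p q P' Q'"
  shows "\<exists>m. {P', Q'} = {shift p q m P, shift p q m Q}"
proof -
  have "{P', Q'} \<in> arc p q P' Q'"
    unfolding arc_def by (auto intro!: exI[of _ 0])
  then have "{P', Q'} \<in> arc p q P Q"
    unfolding assms .
  then show ?thesis
    unfolding arc_def by auto
qed

lemma arc_shift: "arc p q (shift p q m P) (shift p q m Q) = arc p q P Q"
proof -
  have "arc p q P Q \<subseteq> arc p q (shift p q m P) (shift p q m Q)" for m P Q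
  proof
    fix e assume "e \<in> arc p q P Q"
    then obtain m' where "e = {shift p q m' P, shift p q m' Q}"
      unfolding arc_def by auto
    then show "e \<in> arc p q (shift p q m P) (shift p q m Q)"
      unfolding arc_def by (auto simp: shift_shift intro!: exI[of _ "m' - m"])
  qed
  from this[of P Q m] this[of "shift p q m P" "shift p q m Q" "- m"]
  show ?thesis
    by (simp add: shift_shift)
qed

lemma arc_Bot_Top_not_boundary: "\<not> boundary_segment p q (arc p q (Bot j) (Top i))"
  unfolding boundary_segment_def
proof
  assume "(\<exists>k. arc p q (Bot j) (Top i) = arc p q (Bot k) (Bot (k + 1))) \<or>
      (\<exists>k. arc p q (Bot j) (Top i) = arc p q (Top k) (Top (k + 1)))"
  then show False
  proof (elim disjE exE)
    fix k assume "arc p q (Bot j) (Top i) = arc p q (Bot k) (Bot (k + 1))"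
    from arc_eq_shift[OF this] show False by (auto simp: doubleton_eq_iff)
  next
    fix k assume "arc p q (Bot j) (Top i) = arc p q (Top k) (Top (k + 1))"
    from arc_eq_shift[OF this] show False by (auto simp: doubleton_eq_iff)
  qed
qed

text \<open>Translation by m adds m p q to both terms of the height.\<close>

lemma arc_Bot_Top_height:
  assumes "arc p q (Bot j) (Top i) = arc p q (Bot j') (Top i')"
  shows "j * int p - i * int q = j' * int p - i' * int q"
proof -
  obtain m where "j' = j + m * int q" "i' = i + m * int p"
    using arc_eq_shift[OF assms] by (auto simp: doubleton_eq_iff)
  then show ?thesis by (simp add: algebra_simps)
qed

text \<open>Coprimality forces \<open>q dvd j - j'\<close>, and the quotient is the translation.
  Thus arcs between the two boundaries are classified by their heights.\<close>

lemma arc_Bot_Top_eqI: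
  assumes "coprime p q" "q \<ge> 1" and eq: "j * int p - i * int q = j' * int p - i' * int q"
  shows "arc p q (Bot j) (Top i) = arc p q (Bot j') (Top i')"
proof -
  have *: "(j - j') * int p = (i - i') * int q"
    using eq by (simp add: algebra_simps)
  then have "int q dvd (j - j') * int p" by simp
  moreover have "coprime (int q) (int p)"
    using assms(1) by (simp add: coprime_commute)
  ultimately have "int q dvd j - j'"
    using coprime_dvd_mult_left_iff by blast
  then obtain m where m: "j - j' = int q * m" by (rule dvdE)
  with * have "int q * (m * int p) = int q * (i - i')" by (simp add: mult.assoc mult.commute)
  then have "i - i' = m * int p" using assms(2) by simp
  with m have "Bot j = shift p q m (Bot j')" "Top i = shift p q m (Top i')"
    by (simp_all add: mult.commute)
  then show ?thesis
    by (simp only: arc_shift)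
qed

section \<open>Plane determinants and the boundary order\<close>

fun wedge :: "'a::comm_ring_1 \<times> 'a \<Rightarrow> 'a \<times> 'a \<Rightarrow> 'a" where
  "wedge (a, b) (c, d) = a * d - b * c"

text \<open>For vertices u, v, w, z in cyclic order, the diagonals are on the left and the pairs of
  opposite sides on the right: this is the source of the Ptolemy relation.\<close>

lemma pluecker:
  "wedge u w * wedge v z = wedge u v * wedge w z + wedge v w * wedge u z"
  by (cases u; cases v; cases w; cases z) (simp add: algebra_simps)

lemma before_asym: "before P Q \<Longrightarrow> \<not> before Q P"
  by (cases P; cases Q) auto

lemma before_total: "P \<noteq> Q \<Longrightarrow> before P Q \<or> before Q P"
  by (cases P; cases Q) auto

lemma before_trans: "before P Q \<Longrightarrow> before Q R \<Longrightarrow> before P R"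
  by (cases P; cases Q; cases R) auto

section \<open>Height functions\<close>

text \<open>\<open>h v\<close> is the height of the arc at the vertex \<open>v\<close> of the quiver; it is congruent to \<open>v\<close> modulo \<open>N\<close>.\<close>

inductive lowered :: "nat \<Rightarrow> nat \<Rightarrow> (nat \<Rightarrow> int) \<Rightarrow> bool" for p q :: nat where
  lowered_initial: "lowered p q int"
| lowered_step: "lowered p q h \<Longrightarrow> v < p + q \<Longrightarrow>
    h v - int p \<in> h ` {..<p + q} \<Longrightarrow> h v - int q \<in> h ` {..<p + q} \<Longrightarrow>
    lowered p q (h(v := h v - int (p + q)))"

text \<open>The rule is symmetric in p and q, so constructions for the bottom boundary transfer to
  the top.\<close>

lemma lowered_commute: "lowered p q h \<Longrightarrow> lowered q p h"
proof (induction rule: lowered.induct)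
  case (lowered_step h v)
  then have "lowered q p (h(v := h v - int (q + p)))"
    by (intro lowered.lowered_step) (simp_all add: add.commute)
  then show ?case by (simp only: add.commute[of p q])
qed (rule lowered_initial)

lemma lowered_mod: "lowered p q h \<Longrightarrow> v < p + q \<Longrightarrow> h v mod int (p + q) = int v"
proof (induction arbitrary: v rule: lowered.induct)
  case (lowered_step h u)
  then show ?case by (simp del: of_nat_add)
qed simp

lemma lowered_inj:
  "lowered p q h \<Longrightarrow> u < p + q \<Longrightarrow> v < p + q \<Longrightarrow> h u = h v \<Longrightarrow> u = v"
  using lowered_mod by (metis of_nat_eq_iff)

text \<open>Adjacency depends on labels modulo N, so it can be read off from heights.\<close>

lemma lowered_diff_mod:
  "lowered p q h \<Longrightarrow> u < p + q \<Longrightarrow> v < p + q \<Longrightarrow>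
    (int v - int u) mod int (p + q) = (h v - h u) mod int (p + q)"
  by (metis lowered_mod mod_diff_eq)

text \<open>As q \<ge> 2 is coprime to p, it does not divide p. Hence a step by p leaves the class
  of c modulo q and reaches vertices whose heights are untouched.\<close>

lemma lowered_column:
  assumes "coprime p q" "p \<ge> 1" "q \<ge> 2" "c < q"
  shows "\<exists>h. lowered p q h \<and> {int c - int p, int c, int c + int p} \<subseteq> h ` {..<p + q}"
proof -
  \<comment> \<open>the vertices \<open>c + sq\<close> with \<open>s \<ge> t\<close> have been lowered\<close>
  define h where "h t v = (if v < p + q \<and> v mod q = c \<and> c + t * q \<le> v
    then int v - int (p + q) else int v)" for t v
  have not_dvd: "\<not> q dvd p"
    using assms(1,3) coprime_common_divisor_nat[of p q q] by auto
  \<comment> \<open>If v + q is a vertex, it has been lowered to v + q - N = v - p. Otherwise v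
    \<ge> p, and the vertex v - p lies outside the class and keeps its height.\<close>
  have low: "int v - int p \<in> h t ` {..<p + q}"
    if "v < p + q" "v mod q = c" "1 \<le> t" "c + t * q \<le> v + q" for v t
  proof (cases "v + q < p + q")
    case True
    then have "h t (v + q) = int v - int p"
      using that by (simp add: h_def)
    with True show ?thesis by (metis imageI lessThan_iff)
  next
    case False
    have "(v - p) mod q \<noteq> c"
    proof
      assume "(v - p) mod q = c"
      with that(2) False have "q dvd v - (v - p)"
        by (metis diff_le_self mod_eq_dvd_iff_nat)
      with False not_dvd show False by simp
    qed
    with False that have "h t (v - p) = int v - int p"
      by (simp add: h_def of_nat_diff)
    moreover have "v - p < p + q" using that(1) by simp
    ultimately show ?thesis by (metis imageI lessThan_iff)
  qed
  \<comment> \<open>Downward induction on t: at t = p + q the threshold c + tq exceeds every label,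
    and at t = 1 only c itself is spared within its class.\<close>
  have "lowered p q (h 1)"
  proof (rule inc_induct[where j = "p + q" and P = "\<lambda>t. lowered p q (h t)"])
    show "1 \<le> p + q" using assms(2) by simp
    have "v < c + (p + q) * q" if "v < p + q" for v
    proof -
      have "p + q \<le> (p + q) * q"
        using assms(3) by simp
      with that show ?thesis
        by (meson less_le_trans trans_less_add2)
    qed
    then have "h (p + q) = int"
      by (fastforce simp: h_def)
    then show "lowered p q (h (p + q))"
      by (simp add: lowered_initial)
  next
    fix t assume t: "1 \<le> t" and IH: "lowered p q (h (Suc t))"
    define u where "u = c + t * q"
    have u: "u mod q = c" using assms(4) by (simp add: u_def)
    \<comment> \<open>No label of the class lies strictly between u and u + q, so passing from
      \<open>Suc t\<close> to t can change the height of u alone.\<close>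
    have le: "c + Suc t * q \<le> v" if "v mod q = c" "u \<le> v" "v \<noteq> u" for v
    proof -
      have v: "v = c + (v div q) * q"
        using that(1) by (metis add.commute div_mult_mod_eq)
      have "t \<le> v div q"
        using that(2) assms(3) unfolding u_def by (subst (asm) v) simp
      moreover have "t \<noteq> v div q" using v that(3) by (auto simp: u_def)
      ultimately have "Suc t * q \<le> (v div q) * q" by (intro mult_le_mono1) simp
      with v show ?thesis
        by (metis add_left_mono)
    qed
    show "lowered p q (h t)"
    proof (cases "u < p + q")
      case False
      then have "h t = h (Suc t)"
        by (auto simp: h_def u_def fun_eq_iff)
      with IH show ?thesis by simp
    next
      case True
      have hu: "h (Suc t) u = int u"
        using assms(3) by (simp add: h_def u_def)
      have "h t v = ((h (Suc t))(u := h (Suc t) u - int (p + q))) v" for v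
      proof (cases "v = u")
        case True
        then show ?thesis
          using hu u \<open>u < p + q\<close> by (simp add: h_def u_def)
      next
        case False
        then show ?thesis
          using le[of v] by (auto simp: h_def u_def)
      qed
      then have "h t = (h (Suc t))(u := h (Suc t) u - int (p + q))" ..
      moreover have "h (Suc t) u - int p \<in> h (Suc t) ` {..<p + q}"
        using low[of u "Suc t"] True u unfolding hu by (simp add: u_def)
      \<comment> \<open>As t \<ge> 1, u - q is a vertex; it is below the threshold c + (t + 1)q and
        still has its label as height.\<close>
      moreover have "h (Suc t) u - int q \<in> h (Suc t) ` {..<p + q}"
      proof -
        have "q \<le> u" using t by (simp add: u_def) (metis Suc_le_D le_add1 mult_Suc trans_le_add2)
        moreover have "u - q < c + Suc t * q"
          using assms(3) by (simp add: u_def less_imp_diff_less)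
        ultimately have "h (Suc t) (u - q) = int u - int q"
          by (simp add: h_def of_nat_diff)
        with True show ?thesis
          unfolding hu by (metis imageI lessThan_iff less_imp_diff_less)
      qed
      ultimately show ?thesis
        using IH True lowered_step by simp
    qed
  qed
  moreover have "int c - int p \<in> h 1 ` {..<p + q}"
    using low[of c 1] assms(4) by simp
  moreover have "h 1 c = int c" using assms(3) by (simp add: h_def)
  then have "int c \<in> h 1 ` {..<p + q}"
    using assms(4) by (metis imageI lessThan_iff trans_less_add2)
  moreover have "int c + int p \<in> h 1 ` {..<p + q}"
  proof -
    have "(c + p) mod q \<noteq> c"
    proof
      assume "(c + p) mod q = c"
      then have "(c + p) mod q = c mod q" using assms(4) by simp
      then have "q dvd c + p - c" by (metis le_add1 mod_eq_dvd_iff_nat)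
      with not_dvd show False by simp
    qed
    then have "h 1 (c + p) = int c + int p" by (simp add: h_def)
    with assms(4) show ?thesis by (intro image_eqI[of _ _ "c + p"]) auto
  qed
  ultimately show ?thesis by blast
qed

section \<open>The quiver\<close>

lemma mod_diff_inject:
  fixes u w v N :: nat
  assumes "u < N" "w < N" "(int v - int u) mod int N = (int v - int w) mod int N"
  shows "u = w"
proof -
  have "int a = (int v - (int v - int a) mod int N) mod int N" if "a < N" for a
    using that by (simp add: mod_diff_right_eq)
  with assms show ?thesis by (metis of_nat_eq_iff)
qed

text \<open>Holds because -q \<equiv> p modulo p + q and both are proper residues.\<close>

lemma diff_mod_swap:
  fixes u v p q :: nat
  assumes "p \<ge> 1" "q \<ge> 1"
  shows "(int u - int v) mod int (p + q) = int q \<longleftrightarrow> (int v - int u) mod int (p + q) = int p"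
proof -
  have "- a mod int (k + l) = int k" if "a mod int (k + l) = int l" "l \<ge> 1" for a k l
    unfolding zmod_zminus1_eq_if that(1) using that(2) by simp
  from this[of "int u - int v" p q] this[of "int v - int u" q p] assms
  show ?thesis by (auto simp: add.commute)
qed

text \<open>Edges of the cycle in terms of labels: neighbours differ by p, or by -p \<equiv> q. The
  double edge for p = q = 1 is not counted, hence the assumption \<open>p \<noteq> q\<close>
  below.\<close>

definition adjacent :: "nat \<Rightarrow> nat \<Rightarrow> nat \<Rightarrow> nat \<Rightarrow> bool" where
  "adjacent p q u v \<longleftrightarrow> (int v - int u) mod int (p + q) \<in> {int p, int q}"

lemma adjacent_commute: "p \<ge> 1 \<Longrightarrow> q \<ge> 1 \<Longrightarrow> adjacent p q u v \<longleftrightarrow> adjacent p q v u"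
  unfolding adjacent_def using diff_mod_swap[of p q] by blast

text \<open>As p is a unit modulo N, multiplication by p permutes the residues: each label has one
  position on the cycle.\<close>

lemma mult_mod_bij:
  fixes p N :: nat
  assumes "coprime p N" "u < N"
  shows "\<exists>!k. k < N \<and> k * p mod N = u"
proof -
  have inj: "inj_on (\<lambda>k. k * p mod N) {..<N}"
  proof (rule linorder_inj_onI)
    fix k l assume kl: "k < l" "k \<in> {..<N}" "l \<in> {..<N}"
    show "k * p mod N \<noteq> l * p mod N"
    proof
      assume "k * p mod N = l * p mod N"
      then have "N dvd l * p - k * p"
        using kl(1) by (metis less_imp_le_nat mod_eq_dvd_iff_nat mult_le_mono1)
      then have "N dvd (l - k) * p" by (simp add: diff_mult_distrib)
      then have "N dvd l - k"
        using assms(1) by (simp add: coprime_dvd_mult_left_iff coprime_commute)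
      with kl show False
        by (metis diff_is_0_eq dvd_imp_le lessThan_iff less_imp_diff_less linorder_not_le not_gr_zero)
    qed
  qed auto
  have "(\<lambda>k. k * p mod N) ` {..<N} \<subseteq> {..<N}"
    using assms(2) by auto
  then have surj: "(\<lambda>k. k * p mod N) ` {..<N} = {..<N}"
    using inj by (intro endo_inj_surj) auto
  show ?thesis
  proof (rule ex_ex1I)
    have "u \<in> (\<lambda>k. k * p mod N) ` {..<N}" unfolding surj using assms(2) by simp
    then show "\<exists>k<N. k * p mod N = u" by auto
  next
    fix k l assume "k < N \<and> k * p mod N = u" "l < N \<and> l * p mod N = u"
    with inj show "k = l" by (auto dest: inj_onD)
  qed
qed

lemma next_vertex_iff:
  fixes p q k v :: nat
  assumes "q \<ge> 1" "v < p + q"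
  shows "v = (k + 1) * p mod (p + q) \<longleftrightarrow>
    (int v - int (k * p mod (p + q))) mod int (p + q) = int p"
proof
  assume "v = (k + 1) * p mod (p + q)"
  then have "int v = (int (k * p) + int p) mod int (p + q)"
    by (simp add: zmod_int add.commute)
  then have "(int v - int (k * p mod (p + q))) mod int (p + q) = int p mod int (p + q)"
    by (simp add: zmod_int mod_diff_eq del: of_nat_add)
  with assms(1) show "(int v - int (k * p mod (p + q))) mod int (p + q) = int p" by simp
next
  assume *: "(int v - int (k * p mod (p + q))) mod int (p + q) = int p"
  have "int v = (int (k * p mod (p + q)) + (int v - int (k * p mod (p + q))) mod int (p + q)) mod int (p + q)"
    using assms(2) by (simp only: mod_add_right_eq) simp
  also have "\<dots> = int ((k + 1) * p mod (p + q))"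
    unfolding * by (simp only: zmod_int mod_add_left_eq) (simp add: algebra_simps)
  finally show "v = (k + 1) * p mod (p + q)" by simp
qed

text \<open>An edge between u and v starts at the position of u if v - u \<equiv> p, and at that of
  v if v - u \<equiv> q. For p \<noteq> q these exclude each other.\<close>

lemma num_arrows_eq:
  assumes "coprime p q" "p \<ge> 1" "q \<ge> 1" "p \<noteq> q" and uv: "u < p + q" "v < p + q"
  shows "num_arrows p q u v = (if u < v \<and> adjacent p q u v then 1 else 0)"
proof -
  let ?s = "\<lambda>k. k * p mod (p + q)" and ?d = "(int v - int u) mod int (p + q)"
  have cop: "coprime p (p + q)"
    using assms(1) by (simp add: coprime_iff_gcd_eq_1)
  have "card {k. k < p + q \<and> ?s k = w} = 1" if "w < p + q" for w
    using mult_mod_bij[OF cop that] by (auto simp: card_1_singleton_iff)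
  moreover have "{k. k < p + q \<and> u < v \<and> {u, v} = {?s k, (k + 1) * p mod (p + q)}} =
      {k. k < p + q \<and> u < v \<and> (?s k = u \<and> ?d = int p \<or> ?s k = v \<and> ?d = int q)}"
    using next_vertex_iff[OF assms(3) uv(1)] next_vertex_iff[OF assms(3) uv(2)]
      diff_mod_swap[OF assms(2,3), of v u]
    by (intro Collect_cong) (metis doubleton_eq_iff)
  ultimately show ?thesis
    using assms(4) uv unfolding num_arrows_def adjacent_def by auto
qed

text \<open>The sign form persists under the mutations below, with heights in place of
  labels.\<close>

lemma quiver_A_eq:
  assumes "coprime p q" "p \<ge> 1" "q \<ge> 1" "p \<noteq> q" "u < p + q" "v < p + q"
  shows "quiver_A p q u v = (if adjacent p q u v then sgn (int v - int u) else 0)"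
  using assms adjacent_commute[of p q u v] unfolding quiver_A_def
  by (auto simp: num_arrows_eq)

text \<open>The shape of an exchange monomial at a vertex with two neighbours.\<close>

lemma prod_two:
  fixes y :: "nat \<Rightarrow> 'a::comm_monoid_mult"
  assumes "a < N" "b < N" "a \<noteq> b" "\<And>i. i < N \<Longrightarrow> i \<noteq> a \<Longrightarrow> i \<noteq> b \<Longrightarrow> e i = 0"
  shows "(\<Prod>i<N. y i ^ e i) = y a ^ e a * y b ^ e b"
proof -
  have "(\<Prod>i<N. y i ^ e i) = (\<Prod>i\<in>{a, b}. y i ^ e i)"
    using assms by (intro prod.mono_neutral_right) auto
  then show ?thesis using assms(3) by simp
qed

section \<open>The Ptolemy function\<close>

locale annulus =
  fixes p q :: nat and x :: "nat \<Rightarrow> 'a::field_char_0"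
  assumes p_pos: "p \<ge> 1" and q_pos: "q \<ge> 1" and coprime_pq: "coprime p q"
    and indep: "alg_indep (p + q) x"
begin

abbreviation "N \<equiv> p + q"
abbreviation "X \<equiv> xseq p q x"
abbreviation "J \<equiv> periodic_J p q x"
abbreviation "Jt \<equiv> periodic_Jt p q x"

section \<open>The sequence on all integers and its periodic quantities\<close>

lemma X_pos: "X n \<in> pos_rat N x"
  using p_pos q_pos indep by (rule xseq_pos_rat)

lemma X_nonzero [simp]: "X n \<noteq> 0"
  using X_pos indep pos_rat_nonzero by blast

lemma X_initial: "0 \<le> n \<Longrightarrow> n < int N \<Longrightarrow> X n = x (nat n)"
  using p_pos q_pos by (subst xseq.simps) auto

text \<open>For n < 0 this is the backward clause at n, otherwise the forward clause at n + p +
  q.\<close>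

lemma X_rec: "X (n + int p + int q) * X n = X (n + int q) * X (n + int p) + 1"
proof (cases "n < 0")
  case True
  then have "X n = (X (n + int q) * X (n + int p) + 1) / X (n + int p + int q)"
    using p_pos q_pos by (subst xseq.simps) auto
  then show ?thesis by (simp add: field_simps)
next
  case False
  then have "X (n + int p + int q) = (X (n + int q) * X (n + int p) + 1) / X n"
    using p_pos q_pos by (subst xseq.simps) (auto simp: algebra_simps)
  then show ?thesis by (simp add: field_simps)
qed

lemma X_lower: "(X (n - int p) * X (n - int q) + 1) / X n = X (n - int N)"
  using X_rec[of "n - int N"] by (simp add: field_simps)

text \<open>After clearing denominators, the recurrences at n and n + p contribute the same constant
  1, which cancels.\<close>

lemma J_periodic: "J (n + int q) = J n"
  unfolding periodic_J_def
  using X_rec[of n] X_rec[of "n + int p"] by (simp add: field_simps)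

lemma Jt_periodic: "Jt (n + int p) = Jt n"
  unfolding periodic_Jt_def
  using X_rec[of n] X_rec[of "n + int q"] by (simp add: field_simps)

lemma J_periodic_mult: "J (n + m * int q) = J n"
proof (induction m rule: int_induct[where k = 0])
  case (step1 i)
  then show ?case using J_periodic[of "n + i * int q"] by (simp add: algebra_simps)
next
  case (step2 i)
  then show ?case using J_periodic[of "n + (i - 1) * int q"] by (simp add: algebra_simps)
qed simp

lemma Jt_periodic_mult: "Jt (n + m * int p) = Jt n"
proof (induction m rule: int_induct[where k = 0])
  case (step1 i)
  then show ?case using Jt_periodic[of "n + i * int p"] by (simp add: algebra_simps)
next
  case (step2 i)
  then show ?case using Jt_periodic[of "n + (i - 1) * int p"] by (simp add: algebra_simps)
qed simp

text \<open>By periodicity the coefficient does not depend on i: all rows of the tiling satisfy one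
  second-order linear recurrence, which makes the rank 2.\<close>

lemma X_linear:
  "X ((j + 2) * int p - i * int q) =
     J (j * int p) * X ((j + 1) * int p - i * int q) - X (j * int p - i * int q)"
  using J_periodic_mult[of "j * int p" "- i"]
  unfolding periodic_J_def by (simp add: field_simps)

section \<open>Vectors at the marked points\<close>

text \<open>The value at \<open>Top i\<close> is the solution of the two linear equations given by the determinants with
  \<open>vec (Bot 0)\<close> and \<open>vec (Bot 1)\<close>.\<close>

fun vec :: "point \<Rightarrow> 'a \<times> 'a" where
  "vec (Bot j) = (X (j * int p - int q), X (j * int p))"
| "vec (Top i) =
     (X (- i * int q) * X (int p - int q) - X (int p - i * int q) * X (- int q),
      X (- i * int q) * X (int p) - X (int p - i * int q) * X 0)"

text \<open>For j = 0 and j = 1 this is Cramer's rule with determinant 1. Both sides obey the same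
  recurrence in j, so two consecutive values propagate in both directions.\<close>

lemma wedge_Bot_Top: "wedge (vec (Bot j)) (vec (Top i)) = X (j * int p - i * int q)"
proof -
  have u: "X (- int q) * X (int p) - X 0 * X (int p - int q) = 1"
    using X_rec[of "- int q"] by (simp add: algebra_simps)
  let ?E = "\<lambda>j. wedge (vec (Bot j)) (vec (Top i)) = X (j * int p - i * int q)"
  have 0: "?E 0"
  proof -
    have "wedge (vec (Bot 0)) (vec (Top i)) =
        X (- i * int q) * (X (- int q) * X (int p) - X 0 * X (int p - int q))"
      by (simp add: algebra_simps)
    then show ?thesis unfolding u by simp
  qed
  have 1: "?E 1"
  proof -
    have "wedge (vec (Bot 1)) (vec (Top i)) =
        X (int p - i * int q) * (X (- int q) * X (int p) - X 0 * X (int p - int q))"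
      by (simp add: algebra_simps)
    then show ?thesis unfolding u by simp
  qed
  have lin: "wedge (vec (Bot (j + 2))) w =
      J (j * int p) * wedge (vec (Bot (j + 1))) w - wedge (vec (Bot j)) w" for j w
  proof -
    have "X ((j + 2) * int p) = J (j * int p) * X ((j + 1) * int p) - X (j * int p)"
      "X ((j + 2) * int p - int q) =
         J (j * int p) * X ((j + 1) * int p - int q) - X (j * int p - int q)"
      using X_linear[of j 0] X_linear[of j 1] by simp_all
    then show ?thesis
      by (cases w) (simp only: vec.simps wedge.simps, simp add: algebra_simps)
  qed
  have "?E j \<and> ?E (j + 1)"
  proof (induction j rule: int_induct[where k = 0])
    case base
    show ?case using 0 1 by simp
  next
    case (step1 j)
    then show ?case
      using lin[of j "vec (Top i)"] X_linear[of j i] by (simp add: add.assoc del: vec.simps)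
  next
    case (step2 j)
    then show ?case
      using lin[of "j - 1" "vec (Top i)"] X_linear[of "j - 1" i]
      by (simp add: algebra_simps del: vec.simps) (metis add_right_imp_eq)
  qed
  then show ?thesis ..
qed

lemma wedge_Bot_step: "wedge (vec (Bot j)) (vec (Bot (j + 1))) = 1"
  using X_rec[of "j * int p - int q"] by (simp add: algebra_simps)

lemma wedge_Top_step: "wedge (vec (Top (i + 1))) (vec (Top i)) = 1"
proof -
  \<comment> \<open>Both vectors are images of pairs (X(-iq), X(p - iq)) under one matrix, so the
    determinant factors.\<close>
  have "wedge (vec (Top (i + 1))) (vec (Top i)) =
      (X (- (i + 1) * int q) * X (int p - i * int q) - X (- i * int q) * X (int p - (i + 1) * int q))
      * (X (- int q) * X (int p) - X 0 * X (int p - int q))"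
    by (simp add: algebra_simps)
  also have "\<dots> = 1 * 1"
    using X_rec[of "- int q"] X_rec[of "- (i + 1) * int q"]
    by (intro arg_cong2[of _ _ _ _ "(*)"]) (simp_all add: algebra_simps)
  finally show ?thesis by simp
qed

section \<open>Lambda lengths and the Ptolemy relation\<close>

text \<open>The lambda length of the curve, normalised to 1 on boundary segments. Ordering the end
  points removes the sign of the determinant.\<close>

definition lam :: "point \<Rightarrow> point \<Rightarrow> 'a" where
  "lam P Q = (if before P Q then wedge (vec P) (vec Q) else wedge (vec Q) (vec P))"

lemma lam_commute: "lam P Q = lam Q P"
proof (cases "P = Q")
  case False
  then show ?thesis
    using before_asym before_total unfolding lam_def by auto
qed simp

text \<open>Two consecutive top points, of determinant 1, serve as auxiliary vertices. The free
  index i lets \<open>wedge_shift\<close> translate them as well.\<close>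

lemma wedge_Bot_Bot:
  "wedge (vec (Bot j)) (vec (Bot k)) =
     X (j * int p - (i + 1) * int q) * X (k * int p - i * int q)
     - X (j * int p - i * int q) * X (k * int p - (i + 1) * int q)"
  using pluecker[of "vec (Bot j)" "vec (Top (i + 1))" "vec (Bot k)" "vec (Top i)"]
  by (simp only: wedge_Bot_Top wedge_Top_step) (simp add: algebra_simps)

lemma wedge_Top_Top:
  "wedge (vec (Top i)) (vec (Top k)) =
     X (j * int p - i * int q) * X ((j + 1) * int p - k * int q)
     - X ((j + 1) * int p - i * int q) * X (j * int p - k * int q)"
  using pluecker[of "vec (Bot j)" "vec (Top i)" "vec (Bot (j + 1))" "vec (Top k)"]
  by (simp only: wedge_Bot_Top wedge_Bot_step) (simp add: algebra_simps)

text \<open>The vectors themselves change under translation, but mixed determinants depend only on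
  heights, and the others reduce to mixed ones with translated auxiliary points.\<close>

lemma wedge_shift:
  "before P Q \<Longrightarrow> wedge (vec (shift p q m P)) (vec (shift p q m Q)) = wedge (vec P) (vec Q)"
proof (cases P; cases Q)
  fix j k assume "P = Bot j" "Q = Bot k"
  then show ?thesis
    using wedge_Bot_Bot[of "j + m * int q" "k + m * int q" "m * int p"] wedge_Bot_Bot[of j k 0]
    by (simp only: shift.simps) (simp add: algebra_simps del: vec.simps)
next
  fix i k assume "P = Top i" "Q = Top k"
  then show ?thesis
    using wedge_Top_Top[of "i + m * int p" "k + m * int p" "m * int q"] wedge_Top_Top[of i k 0]
    by (simp only: shift.simps) (simp add: algebra_simps del: vec.simps)
next
  fix j i assume "P = Bot j" "Q = Top i"
  then show ?thesis
    by (simp only: shift.simps wedge_Bot_Top) (simp add: algebra_simps)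
qed auto

lemma before_shift: "before (shift p q m P) (shift p q m Q) = before P Q"
  by (cases P; cases Q) auto

lemma lam_shift: "lam (shift p q m P) (shift p q m Q) = lam P Q"
proof (cases "P = Q")
  case True
  have "wedge u u = 0" for u :: "'a \<times> 'a" by (cases u) simp
  with True show ?thesis by (simp add: lam_def)
next
  case False
  then show ?thesis
    using before_total[of P Q] wedge_shift by (auto simp: lam_def before_shift)
qed

text \<open>Makes \<open>lam\<close> a function of the arc in the annulus, independent of the lift
  and its direction.\<close>

lemma lam_arc_cong:
  assumes "arc p q P Q = arc p q P' Q'"
  shows "lam P Q = lam P' Q'"
  using arc_eq_shift[OF assms] lam_shift lam_commute by (metis doubleton_eq_iff)

lemma lam_Bot_Top: "lam (Bot j) (Top i) = X (j * int p - i * int q)"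
  by (simp only: lam_def before.simps if_True wedge_Bot_Top)

lemma lam_Bot_step: "lam (Bot j) (Bot (j + 1)) = 1"
  by (simp add: lam_def wedge_Bot_step del: vec.simps)

lemma lam_Top_step: "lam (Top i) (Top (i + 1)) = 1"
  by (simp add: lam_def wedge_Top_step del: vec.simps)

lemma lam_boundary: "boundary_segment p q (arc p q P Q) \<Longrightarrow> lam P Q = 1"
  using lam_arc_cong lam_Bot_step lam_Top_step unfolding boundary_segment_def by metis

lemma lam_increasing4:
  assumes "increasing4 A B C D"
  shows "lam A C * lam B D = lam A B * lam C D + lam B C * lam A D"
  using assms pluecker[of "vec A" "vec C" "vec B" "vec D"]
  unfolding increasing4_def lam_def by (auto dest: before_trans)

text \<open>Rotating the four points only permutes the factors, so each rotation reduces to the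
  increasing case.\<close>

lemma lam_ptolemy:
  assumes "cyclic4 A B C D"
  shows "lam A C * lam B D = lam A B * lam C D + lam B C * lam D A"
  using assms lam_increasing4[of A B C D] lam_increasing4[of B C D A]
    lam_increasing4[of C D A B] lam_increasing4[of D A B C]
  unfolding cyclic4_def by (auto simp: lam_commute algebra_simps)

section \<open>Positivity of the determinants\<close>

text \<open>Induction along a fan with apex \<open>Top 0\<close>: each Ptolemy relation gives the
  next determinant without subtraction.\<close>

lemma wedge_Bot_Bot_pos: "wedge (vec (Bot j)) (vec (Bot (j + 1 + int d))) \<in> pos_rat N x"
proof (induction d)
  case 0
  show ?case using pos_rat_one by (simp add: wedge_Bot_step del: vec.simps)
next
  case (Suc d)
  let ?w = "\<lambda>k. wedge (vec (Bot j)) (vec (Bot k))" and ?k = "j + 1 + int d"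
  have "?w (?k + 1) = (?w ?k * X ((?k + 1) * int p) + X (j * int p)) / X (?k * int p)"
    using pluecker[of "vec (Bot j)" "vec (Bot (?k + 1))" "vec (Bot ?k)" "vec (Top 0)"]
    by (simp only: wedge_Bot_Top wedge_Bot_step) (simp add: field_simps del: vec.simps)
  also have "\<dots> \<in> pos_rat N x"
    using Suc X_pos indep by (intro pos_rat_divide pos_rat_add pos_rat_mult)
  finally show ?case by (simp add: add.assoc add.commute del: vec.simps)
qed

lemma wedge_Top_Top_pos: "wedge (vec (Top (i + 1 + int d))) (vec (Top i)) \<in> pos_rat N x"
proof (induction d)
  case 0
  show ?case using pos_rat_one by (simp add: wedge_Top_step del: vec.simps)
next
  case (Suc d)
  let ?w = "\<lambda>k. wedge (vec (Top k)) (vec (Top i))" and ?k = "i + 1 + int d"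
  have "?w (?k + 1) = (X (- (?k + 1) * int q) * ?w ?k + X (- i * int q)) / X (- ?k * int q)"
    using pluecker[of "vec (Bot 0)" "vec (Top ?k)" "vec (Top (?k + 1))" "vec (Top i)"]
    by (simp only: wedge_Bot_Top wedge_Top_step) (simp add: field_simps del: vec.simps)
  also have "\<dots> \<in> pos_rat N x"
    using Suc X_pos indep by (intro pos_rat_divide pos_rat_add pos_rat_mult)
  finally show ?case by (simp add: add.assoc add.commute del: vec.simps)
qed

lemma wedge_pos: "before P Q \<Longrightarrow> wedge (vec P) (vec Q) \<in> pos_rat N x"
proof (cases P; cases Q)
  fix j k assume "before P Q" "P = Bot j" "Q = Bot k"
  then show ?thesis using wedge_Bot_Bot_pos[of j "nat (k - j - 1)"] by (simp del: vec.simps)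
next
  fix i k assume "before P Q" "P = Top i" "Q = Top k"
  then show ?thesis using wedge_Top_Top_pos[of k "nat (i - k - 1)"] by (simp del: vec.simps)
next
  fix j i assume "P = Bot j" "Q = Top i"
  then show ?thesis using X_pos by (simp only: wedge_Bot_Top)
qed auto

lemma lam_nonzero: "P \<noteq> Q \<Longrightarrow> lam P Q \<noteq> 0"
  using wedge_pos pos_rat_nonzero[OF indep] before_total unfolding lam_def by metis

section \<open>Arc values under flips\<close>

definition lam_valued :: "(arc \<rightharpoonup> 'a) \<Rightarrow> bool" where
  "lam_valued T \<longleftrightarrow> (\<forall>P Q f. T (arc p q P Q) = Some f \<longrightarrow> f = lam P Q)"

text \<open>With d = kp div N, (k - d)p - dq = kp - dN; d \<le> k makes the natural subtraction
  exact.\<close>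

lemma initial_height:
  "int (k - k * p div N) * int p - int (k * p div N) * int q = int (k * p mod N)"
proof -
  have "k * p div N \<le> k"
    by (metis div_le_mono div_mult_self_is_m add_gr_0 le_add1 less_le_trans mult_le_mono2 p_pos zero_less_one)
  then have "int (k - k * p div N) * int p - int (k * p div N) * int q
      = int (k * p) - int (N * (k * p div N))"
    by (simp add: algebra_simps of_nat_diff)
  also have "\<dots> = int (k * p mod N)"
    by (metis minus_mult_div_eq_mod of_nat_diff times_div_less_eq_dividend)
  finally show ?thesis .
qed

lemma lam_valued_initial: "lam_valued (initial_triangulation p q x)"
  unfolding lam_valued_def
proof (intro allI impI)
  fix P Q f assume "initial_triangulation p q x (arc p q P Q) = Some f"
  then obtain k where k: "k < N" "f = x (k * p mod N)"
      "arc p q P Q = arc p q (Bot (int (k - k * p div N))) (Top (int (k * p div N)))"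
    unfolding initial_triangulation_def by (auto dest!: map_of_SomeD)
  have "lam P Q = X (int (k * p mod N))"
    using lam_arc_cong[OF k(3)] lam_Bot_Top initial_height by simp
  also have "\<dots> = f"
    using k(2) p_pos mod_less_divisor[of N "k * p"] by (subst X_initial) (simp_all del: mod_less_divisor)
  finally show "f = lam P Q" ..
qed

lemma side_value_lam_valued:
  "lam_valued T \<Longrightarrow> side_value p q T (arc p q P Q) = Some f \<Longrightarrow> f = lam P Q"
  unfolding lam_valued_def side_value_def
  by (auto split: if_splits simp: lam_boundary)

text \<open>The exchange formula is the Ptolemy relation solved for the new diagonal; the old one is
  nonzero because its end points differ.\<close>

lemma lam_valued_flip: "flip p q T T' \<Longrightarrow> lam_valued T \<Longrightarrow> lam_valued T'"
proof (induction rule: flip.induct)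
  case (1 A B C D T k a b c d)
  have "A \<noteq> C"
    using 1(1) unfolding cyclic4_def increasing4_def by (auto dest: before_trans before_asym)
  then have "lam A C \<noteq> 0" by (rule lam_nonzero)
  moreover have "k = lam A C" "a = lam A B" "b = lam B C" "c = lam C D" "d = lam D A"
    using 1 side_value_lam_valued unfolding lam_valued_def by blast+
  ultimately have "(a * c + b * d) / k = lam B D"
    using lam_ptolemy[OF 1(1)] by (simp add: field_simps)
  then have "(a * c + b * d) / k = lam P Q" if "arc p q P Q = arc p q B D" for P Q
    using lam_arc_cong[OF that] by simp
  moreover have "f = lam P Q" if "T (arc p q P Q) = Some f" for P Q f
    using 1(7) that unfolding lam_valued_def by blast
  ultimately show ?case
    unfolding lam_valued_def fun_upd_apply by (metis option.distinct(1) option.inject)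
qed

lemma lam_valued_reachable:
  "(flip p q)\<^sup>*\<^sup>* (initial_triangulation p q x) T \<Longrightarrow> lam_valued T"
  by (induction rule: rtranclp_induct) (auto intro: lam_valued_initial lam_valued_flip)

text \<open>Uniqueness of the value is the invariant, so one reachable triangulation containing the
  arc suffices.\<close>

lemma arc_variable_lam:
  assumes "(flip p q)\<^sup>*\<^sup>* (initial_triangulation p q x) T" "T (arc p q P Q) \<noteq> None"
  shows "arc_variable p q x (arc p q P Q) (lam P Q)"
proof -
  have "f = lam P Q"
    if "(flip p q)\<^sup>*\<^sup>* (initial_triangulation p q x) T'" "T' (arc p q P Q) = Some f" for T' f
    using lam_valued_reachable[OF that(1)] that(2) unfolding lam_valued_def by blast
  with assms show ?thesis
    unfolding arc_variable_def arc_values_def by blast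
qed

text \<open>Ptolemy with fourth vertex \<open>Top 0\<close>, chosen so that the heights involved are
  multiples of p.\<close>

lemma lam_Bot_jump: "lam (Bot j) (Bot (j + 2)) = J (j * int p)"
proof -
  have "cyclic4 (Bot j) (Bot (j + 1)) (Bot (j + 2)) (Top 0)"
    by (simp add: cyclic4_def increasing4_def)
  moreover have "lam (Bot (j + 1)) (Bot (j + 2)) = 1"
    using lam_Bot_step[of "j + 1"] by (simp add: add.assoc)
  ultimately have "lam (Bot j) (Bot (j + 2)) * X ((j + 1) * int p) =
      X ((j + 2) * int p) + X (j * int p)"
    using lam_ptolemy[of "Bot j" "Bot (j + 1)" "Bot (j + 2)" "Top 0"]
    by (simp add: lam_Bot_Top lam_Bot_step lam_commute[of "Top 0"])
  then show ?thesis
    unfolding periodic_J_def by (simp add: field_simps)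
qed

lemma lam_Top_jump: "lam (Top i) (Top (i - 2)) = Jt (- i * int q)"
proof -
  have "cyclic4 (Bot 0) (Top i) (Top (i - 1)) (Top (i - 2))"
    by (simp add: cyclic4_def increasing4_def)
  moreover have "lam (Top i) (Top (i - 1)) = 1" "lam (Top (i - 1)) (Top (i - 2)) = 1"
    using lam_Top_step[of "i - 1"] lam_Top_step[of "i - 2"]
    by (simp_all add: lam_commute[of "Top i" "Top (i - 1)"] lam_commute[of "Top (i - 1)" "Top (i - 2)"])
  ultimately have "X (0 * int p - (i - 1) * int q) * lam (Top i) (Top (i - 2)) =
      X (0 * int p - i * int q) + X (0 * int p - (i - 2) * int q)"
    using lam_ptolemy[of "Bot 0" "Top i" "Top (i - 1)" "Top (i - 2)"]
    by (simp add: lam_Bot_Top lam_commute[of "Top (i - 2)" "Bot 0"])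
  moreover have "0 * int p - (i - 1) * int q = - i * int q + int q"
      "0 * int p - (i - 2) * int q = - i * int q + 2 * int q"
    by (simp_all add: algebra_simps)
  ultimately show ?thesis
    unfolding periodic_Jt_def by (simp add: field_simps)
qed

section \<open>Flips and mutations along height functions\<close>

lemma initial_triangulation_defined:
  assumes "j * int p - i * int q \<in> {0..<int N}"
  shows "initial_triangulation p q x (arc p q (Bot j) (Top i)) \<noteq> None"
proof -
  \<comment> \<open>The indices of the k-th initial arc add up to k, and translations change i + j
    by multiples of N.\<close>
  define k where "k = nat ((i + j) mod int N)"
  have k: "int k = (i + j) mod int N" "k < N"
    using p_pos by (auto simp: k_def nat_less_iff)
  have "int (k * p mod N) = ((i + j) * int p) mod int N"
    by (simp only: zmod_int of_nat_mult k(1) mod_mult_left_eq)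
  also have "(i + j) * int p = (j * int p - i * int q) + i * int N"
    by (simp add: algebra_simps)
  also have "\<dots> mod int N = j * int p - i * int q"
    using assms by simp
  finally have "arc p q (Bot j) (Top i) =
      arc p q (Bot (int (k - k * p div N))) (Top (int (k * p div N)))"
    by (intro arc_Bot_Top_eqI coprime_pq q_pos) (simp only: initial_height)
  with k(2) show ?thesis
    unfolding initial_triangulation_def map_of_eq_None_iff by force
qed

lemma exists_height: "\<exists>j i. j * int p - i * int q = n"
proof -
  have "gcd (int p) (int q) = 1" using coprime_pq by simp
  then obtain a b where "a * int p + b * int q = 1"
    using bezout_int[of "int p" "int q"] by auto
  then have "n * (a * int p + b * int q) = n" by simp
  then have "(n * a) * int p - (- n * b) * int q = n"
    by (simp add: algebra_simps)
  then show ?thesis by blast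
qed

lemma side_value_Bot_Top: "side_value p q T (arc p q (Bot j) (Top i)) = T (arc p q (Bot j) (Top i))"
  by (simp add: side_value_def arc_Bot_Top_not_boundary)

lemma side_value_Bot: "side_value p q T (arc p q (Bot j) (Bot (j + 1))) = Some 1"
  unfolding side_value_def boundary_segment_def by auto

lemma side_value_Top: "side_value p q T (arc p q (Top (i + 1)) (Top i)) = Some 1"
  unfolding side_value_def boundary_segment_def by (auto simp: arc_commute[of p q "Top (i + 1)"])

text \<open>Further arcs are allowed, since a flip depends only on the arcs of one
  quadrilateral.\<close>

definition heights_in :: "int set \<Rightarrow> (arc \<rightharpoonup> 'a) \<Rightarrow> bool" where
  "heights_in S T \<longleftrightarrow>
     (\<forall>j i. j * int p - i * int q \<in> S \<longrightarrow> T (arc p q (Bot j) (Top i)) \<noteq> None)"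

lemma heights_inE:
  assumes "heights_in S T" "n \<in> S" "j * int p - i * int q = n"
  obtains f where "T (arc p q (Bot j) (Top i)) = Some f"
  using assms unfolding heights_in_def by blast

text \<open>The quadrilateral has two boundary segments and sides of heights n - p and n - q; its
  diagonals have heights n and n - N.\<close>

lemma heights_in_flip:
  assumes T: "heights_in S T" and n: "n \<in> S" "n - int p \<in> S" "n - int q \<in> S"
  shows "\<exists>T'. flip p q T T' \<and> heights_in (insert (n - int N) (S - {n})) T'"
proof -
  obtain j i where ji: "j * int p - i * int q = n"
    using exists_height by blast
  have "(j - 1) * int p - i * int q = n - int p" "j * int p - (i + 1) * int q = n - int q"
    and new: "(j - 1) * int p - (i + 1) * int q = n - int N"
    using ji by (simp_all add: algebra_simps)
  then obtain k a c where
    "T (arc p q (Bot j) (Top i)) = Some k"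
    "T (arc p q (Bot j) (Top (i + 1))) = Some a"
    "T (arc p q (Bot (j - 1)) (Top i)) = Some c"
    using heights_inE[OF T] n ji by metis
  moreover have "cyclic4 (Bot j) (Top (i + 1)) (Top i) (Bot (j - 1))"
    by (simp add: cyclic4_def increasing4_def)
  ultimately have "flip p q T (T(arc p q (Bot j) (Top i) := None,
      arc p q (Top (i + 1)) (Bot (j - 1)) := Some ((a * c + 1 * 1) / k)))" (is "flip p q T ?T'")
    using side_value_Bot[of T "j - 1"] side_value_Top[of T i]
    by (intro flip.intros) (simp_all add: side_value_Bot_Top arc_commute[of p q "Top i"])
  moreover have "heights_in (insert (n - int N) (S - {n})) ?T'"
    unfolding heights_in_def
  proof (intro allI impI)
    fix j' i' assume *: "j' * int p - i' * int q \<in> insert (n - int N) (S - {n})"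
    show "?T' (arc p q (Bot j') (Top i')) \<noteq> None"
    proof (cases "j' * int p - i' * int q = n - int N")
      case True
      then have "arc p q (Bot j') (Top i') = arc p q (Bot (j - 1)) (Top (i + 1))"
        using new coprime_pq q_pos by (intro arc_Bot_Top_eqI) simp_all
      then show ?thesis by (simp add: arc_commute[of p q "Top (i + 1)"])
    next
      case False
      with * have "j' * int p - i' * int q \<noteq> n" "T (arc p q (Bot j') (Top i')) \<noteq> None"
        using T unfolding heights_in_def by blast+
      moreover have "arc p q (Bot j') (Top i') \<noteq> arc p q (Bot j) (Top i)"
        using arc_Bot_Top_height[of p q j' i' j i] ji calculation(1) by blast
      ultimately show ?thesis by simp
    qed
  qed
  ultimately show ?thesis by blast
qed

lemma lowered_triangulation:
  "lowered p q h \<Longrightarrow>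
    \<exists>T. (flip p q)\<^sup>*\<^sup>* (initial_triangulation p q x) T \<and> heights_in (h ` {..<N}) T"
proof (induction rule: lowered.induct)
  case lowered_initial
  have "heights_in (int ` {..<N}) (initial_triangulation p q x)"
    unfolding heights_in_def using initial_triangulation_defined by fastforce
  then show ?case by blast
next
  case (lowered_step h v)
  then obtain T where T: "(flip p q)\<^sup>*\<^sup>* (initial_triangulation p q x) T" "heights_in (h ` {..<N}) T"
    by blast
  with lowered_step heights_in_flip[of "h ` {..<N}" T "h v"]
  obtain T' where "flip p q T T'" "heights_in (insert (h v - int N) (h ` {..<N} - {h v})) T'"
    by auto
  \<comment> \<open>By injectivity v is the only vertex of height \<open>h v\<close>, so this height
    disappears.\<close>
  moreover have "(h(v := h v - int N)) ` {..<N} \<subseteq> insert (h v - int N) (h ` {..<N} - {h v})"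
    using lowered_inj lowered_step.hyps(1,2) by (fastforce split: if_splits)
  ultimately show ?case
    using T(1) unfolding heights_in_def by (meson rtranclp.rtrancl_into_rtrancl subsetD)
qed

text \<open>The quadrilateral has two bottom segments and sides of heights c - p and c + p meeting
  at \<open>Top i\<close>; flipping its diagonal of height c gives the jump.\<close>

lemma flip_Bot:
  assumes "lowered p q h" and c: "{c - int p, c, c + int p} \<subseteq> h ` {..<N}"
    and ji: "(j + 1) * int p - i * int q = c"
  shows "\<exists>T. (flip p q)\<^sup>*\<^sup>* (initial_triangulation p q x) T \<and> T (arc p q (Bot j) (Bot (j + 2))) \<noteq> None"
proof -
  obtain T where T: "(flip p q)\<^sup>*\<^sup>* (initial_triangulation p q x) T" "heights_in (h ` {..<N}) T"
    using lowered_triangulation assms(1) by blast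
  have "j * int p - i * int q = c - int p" "(j + 2) * int p - i * int q = c + int p"
    using ji by (simp_all add: algebra_simps)
  then obtain k b c where
    "T (arc p q (Bot (j + 1)) (Top i)) = Some k"
    "T (arc p q (Bot (j + 2)) (Top i)) = Some b"
    "T (arc p q (Bot j) (Top i)) = Some c"
    using heights_inE[OF T(2)] c ji by (metis insert_subset)
  moreover have "cyclic4 (Bot (j + 1)) (Bot (j + 2)) (Top i) (Bot j)"
    by (simp add: cyclic4_def increasing4_def)
  ultimately have "flip p q T (T(arc p q (Bot (j + 1)) (Top i) := None,
      arc p q (Bot (j + 2)) (Bot j) := Some ((1 * c + b * 1) / k)))" (is "flip p q T ?T'")
    using side_value_Bot[of T "j + 1"] side_value_Bot[of T j]
    by (intro flip.intros) (simp_all add: side_value_Bot_Top arc_commute[of p q "Top i"] add.assoc)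
  with T(1) have "(flip p q)\<^sup>*\<^sup>* (initial_triangulation p q x) ?T'"
    using rtranclp.rtrancl_into_rtrancl[of "flip p q"] by metis
  moreover have "?T' (arc p q (Bot j) (Bot (j + 2))) \<noteq> None"
    by (simp add: arc_commute[of p q "Bot j"])
  ultimately show ?thesis by blast
qed

lemma flip_Top:
  assumes "lowered p q h" and c: "{c - int q, c, c + int q} \<subseteq> h ` {..<N}"
    and ji: "j * int p - (i - 1) * int q = c"
  shows "\<exists>T. (flip p q)\<^sup>*\<^sup>* (initial_triangulation p q x) T \<and> T (arc p q (Top i) (Top (i - 2))) \<noteq> None"
proof -
  obtain T where T: "(flip p q)\<^sup>*\<^sup>* (initial_triangulation p q x) T" "heights_in (h ` {..<N}) T"
    using lowered_triangulation assms(1) by blast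
  have "j * int p - i * int q = c - int q" "j * int p - (i - 2) * int q = c + int q"
    using ji by (simp_all add: algebra_simps)
  then obtain k a d where
    "T (arc p q (Bot j) (Top (i - 1))) = Some k"
    "T (arc p q (Bot j) (Top i)) = Some a"
    "T (arc p q (Bot j) (Top (i - 2))) = Some d"
    using heights_inE[OF T(2)] c ji by (metis insert_subset)
  moreover have "cyclic4 (Bot j) (Top i) (Top (i - 1)) (Top (i - 2))"
    by (simp add: cyclic4_def increasing4_def)
  ultimately have "flip p q T (T(arc p q (Bot j) (Top (i - 1)) := None,
      arc p q (Top i) (Top (i - 2)) := Some ((a * 1 + 1 * d) / k)))" (is "flip p q T ?T'")
    using side_value_Top[of T "i - 1"] side_value_Top[of T "i - 2"]
    by (intro flip.intros) (simp_all add: side_value_Bot_Top arc_commute[of p q "Top (i - 2)" "Bot j"])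
  with T(1) have "(flip p q)\<^sup>*\<^sup>* (initial_triangulation p q x) ?T'"
    using rtranclp.rtrancl_into_rtrancl[of "flip p q"] by metis
  moreover have "?T' (arc p q (Top i) (Top (i - 2))) \<noteq> None"
    by simp
  ultimately show ?thesis by blast
qed

section \<open>Seeds along height functions\<close>

text \<open>The underlying cycle is fixed; heights determine its orientation, each edge going from
  lower to higher.\<close>

definition height_seed :: "(nat \<Rightarrow> int) \<Rightarrow> 'a seed \<Rightarrow> bool" where
  "height_seed h S \<longleftrightarrow> (\<forall>u<N. snd S u = X (h u)) \<and>
     (\<forall>u<N. \<forall>v<N. fst S u v = (if adjacent p q u v then sgn (h v - h u) else 0))"

text \<open>Heights h v - q and h v + p agree modulo N, so one lemma covers both the sinks and the
  final exchange.\<close>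

lemma adjacent_heights:
  assumes "lowered p q h" "u < N" "v < N" "a < N" "b < N"
    and "h a = h v - int p" "h b = h v - int q \<or> h b = h v + int p"
  shows "adjacent p q u v \<longleftrightarrow> u = a \<or> u = b"
proof -
  have a: "(int v - int a) mod int N = int p"
    using lowered_diff_mod[OF assms(1,4,3)] assms(6) q_pos by simp
  have "(int v - int b) mod int N = int q"
    using assms(7)
  proof
    assume "h b = h v - int q"
    then show ?thesis using lowered_diff_mod[OF assms(1,5,3)] p_pos by simp
  next
    assume "h b = h v + int p"
    then have "(int b - int v) mod int N = int p"
      using lowered_diff_mod[OF assms(1,3,5)] q_pos by simp
    then show ?thesis using diff_mod_swap[OF p_pos q_pos] by blast
  qed
  with a show ?thesis
    unfolding adjacent_def using mod_diff_inject assms(2,4,5) by (metis insert_iff empty_iff)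
qed

lemma lowered_seed:
  assumes "p \<noteq> q"
  shows "lowered p q h \<Longrightarrow>
    \<exists>B y. mutation_reachable N (quiver_A p q, x) (B, y) \<and> height_seed h (B, y)"
proof (induction rule: lowered.induct)
  case lowered_initial
  have "height_seed int (quiver_A p q, x)"
    unfolding height_seed_def
    using assms p_pos q_pos coprime_pq by (auto simp: X_initial quiver_A_eq)
  then show ?case using mutation_reachable.intros(1) by blast
next
  case (lowered_step h v)
  then obtain B y where reach: "mutation_reachable N (quiver_A p q, x) (B, y)"
    and seed: "height_seed h (B, y)" by blast
  have y: "y u = X (h u)" if "u < N" for u
    using seed that by (simp add: height_seed_def)
  have B: "B u w = (if adjacent p q u w then sgn (h w - h u) else 0)" if "u < N" "w < N" for u w
    using seed that by (simp add: height_seed_def)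
  obtain a b where ab: "a < N" "b < N" "h a = h v - int p" "h b = h v - int q"
    using lowered_step.hyps(3,4) by (metis imageE lessThan_iff)
  note v = lowered_step.hyps(2)
  have nbr: "adjacent p q u v \<longleftrightarrow> u = a \<or> u = b" if "u < N" for u
    using adjacent_heights[OF lowered_step.hyps(1) that v ab(1,2)] ab(3,4) by blast
  have nbr': "adjacent p q v u \<longleftrightarrow> u = a \<or> u = b" if "u < N" for u
    using nbr[OF that] adjacent_commute[OF p_pos q_pos] by blast
  have "a \<noteq> b" using ab assms by auto
  \<comment> \<open>Both neighbours are lower, so v is a sink.\<close>
  have Bv: "B u v = (if u = a \<or> u = b then 1 else 0)" "B v u = (if u = a \<or> u = b then - 1 else 0)"
    if "u < N" for u
    using that v ab p_pos q_pos nbr nbr' by (auto simp: B)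
  have "mutate_cluster N v B y v = (X (h v - int p) * X (h v - int q) + 1) / X (h v)"
    using prod_two[OF ab(1,2) \<open>a \<noteq> b\<close>, of "\<lambda>u. nat (B u v)" y]
      prod_two[OF ab(1,2) \<open>a \<noteq> b\<close>, of "\<lambda>u. nat (- B u v)" y]
    using ab v by (simp add: mutate_cluster_def Bv y)
  then have y': "mutate_cluster N v B y u = X ((h(v := h v - int N)) u)" if "u < N" for u
    using that y by (auto simp: X_lower) (simp add: mutate_cluster_def)
  let ?h = "h(v := h v - int N)"
  \<comment> \<open>The new height of v is below both neighbours, which reverses the arrows there.
    At a sink no path passes through v, so no other entry changes.\<close>
  have B': "mutate_quiver v B u w = (if adjacent p q u w then sgn (?h w - ?h u) else 0)"
    if "u < N" "w < N" for u w
  proof -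
    consider "u = v" "w = v" | "u = v" "w \<noteq> v" | "u \<noteq> v" "w = v" | "u \<noteq> v" "w \<noteq> v"
      by blast
    then show ?thesis
    proof cases
      case 1
      then show ?thesis
        using v by (simp add: mutate_quiver_def B)
    next
      case 2
      then show ?thesis
        using that ab p_pos q_pos by (auto simp: mutate_quiver_def Bv nbr')
    next
      case 3
      then show ?thesis
        using that ab p_pos q_pos by (auto simp: mutate_quiver_def Bv nbr)
    next
      case 4
      then show ?thesis
        using that by (simp add: mutate_quiver_def Bv) (simp add: B)
    qed
  qed
  have "height_seed ?h (mutate_quiver v B, mutate_cluster N v B y)"
    unfolding height_seed_def using y' B' by simp
  then show ?case
    using mutation_reachable.intros(2)[OF reach v] by blast
qed

text \<open>The vertex of height c has one incoming arrow, from height c - d, and one outgoing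
  arrow, to c + d. Each exchange monomial is therefore a single variable.\<close>

lemma flat_cluster_variable:
  assumes "p \<noteq> q" "lowered p q h" "{c - d, c, c + d} \<subseteq> h ` {..<N}" "d = int p \<or> d = int q"
  shows "(X (c + d) + X (c - d)) / X c \<in> cluster_variables N (quiver_A p q) x"
proof -
  obtain a b v where ab: "a < N" "b < N" "v < N" "h a = h v - d" "h b = h v + d" "c = h v"
    using assms(3) by (auto simp: image_iff)
  have "d > 0" using assms(4) p_pos q_pos by auto
  obtain B y where reach: "mutation_reachable N (quiver_A p q, x) (B, y)"
    and seed: "height_seed h (B, y)"
    using lowered_seed[OF assms(1,2)] by blast
  have y: "y u = X (h u)" if "u < N" for u
    using seed that by (simp add: height_seed_def)
  have nbr: "adjacent p q u v \<longleftrightarrow> u = a \<or> u = b" if "u < N" for u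
    using assms(4)
  proof
    assume "d = int p"
    with ab adjacent_heights[OF assms(2) that ab(3,1,2)] show ?thesis by blast
  next
    assume "d = int q"
    \<comment> \<open>Adjacency is symmetric in p and q, so the neighbour lemma applies with their
      roles exchanged.\<close>
    have "annulus q p x"
      using annulus_axioms unfolding annulus_def by (simp add: add.commute coprime_commute)
    from annulus.adjacent_heights[OF this, OF lowered_commute[OF assms(2)], of u v a b]
    show ?thesis
      using that ab \<open>d = int q\<close> by (simp add: adjacent_def add.commute insert_commute)
  qed
  have "a \<noteq> b" using ab \<open>d > 0\<close> by auto
  have Bv: "B u v = (if u = a then 1 else if u = b then - 1 else 0)" if "u < N" for u
    using seed that ab \<open>d > 0\<close> nbr by (auto simp: height_seed_def)
  have "mutate_cluster N v B y v = (X (c - d) + X (c + d)) / X c"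
    using prod_two[OF ab(1,2) \<open>a \<noteq> b\<close>, of "\<lambda>u. nat (B u v)" y]
      prod_two[OF ab(1,2) \<open>a \<noteq> b\<close>, of "\<lambda>u. nat (- B u v)" y]
    using ab \<open>a \<noteq> b\<close> by (simp add: mutate_cluster_def Bv y)
  moreover have "mutation_reachable N (quiver_A p q, x) (mutate_quiver v B, mutate_cluster N v B y)"
    using reach ab(3) by (rule mutation_reachable.intros(2))
  then have "mutate_cluster N v B y v \<in> cluster_variables N (quiver_A p q) x"
    unfolding cluster_variables_def using ab(3) by blast
  ultimately show ?thesis by (simp add: add.commute)
qed

section \<open>Arcs jumping over one boundary vertex\<close>

lemma Bot_jump:
  assumes "q \<ge> 2"
  shows "arc_variable p q x (arc p q (Bot j) (Bot (j + 2))) (J (j * int p))"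
    and "J (j * int p) \<in> cluster_variables N (quiver_A p q) x"
proof -
  \<comment> \<open>The top point is chosen so that the arc from \<open>Bot (j + 1)\<close> has its
    height c among the residues below q.\<close>
  define i where "i = (j + 1) * int p div int q"
  define c where "c = nat ((j + 1) * int p mod int q)"
  have c: "int c = (j + 1) * int p mod int q" "c < q"
    using q_pos by (auto simp: c_def nat_less_iff)
  have ji: "(j + 1) * int p - i * int q = int c"
    unfolding i_def c(1) by (metis minus_div_mult_eq_mod)
  obtain h where h: "lowered p q h" "{int c - int p, int c, int c + int p} \<subseteq> h ` {..<N}"
    using lowered_column[OF coprime_pq p_pos assms c(2)] by blast
  show "arc_variable p q x (arc p q (Bot j) (Bot (j + 2))) (J (j * int p))"
    using flip_Bot[OF h ji] arc_variable_lam lam_Bot_jump by metis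
  have "p \<noteq> q" using coprime_pq assms by auto
  \<comment> \<open>Periodicity moves the index jp to c - p, where the exchange at height c yields
    it.\<close>
  have "J (j * int p) = J (j * int p + - i * int q)"
    by (simp only: J_periodic_mult)
  also have "j * int p + - i * int q = int c - int p"
    using ji by (simp add: algebra_simps)
  also have "J (int c - int p) = (X (int c + int p) + X (int c - int p)) / X (int c)"
    by (simp add: periodic_J_def add.commute)
  finally show "J (j * int p) \<in> cluster_variables N (quiver_A p q) x"
    using flat_cluster_variable[OF \<open>p \<noteq> q\<close> h] by simp
qed

lemma Top_jump:
  assumes "p \<ge> 2"
  shows "arc_variable p q x (arc p q (Top i) (Top (i - 2))) (Jt (- i * int q))"
    and "Jt (- i * int q) \<in> cluster_variables N (quiver_A p q) x"
proof -
  \<comment> \<open>Here the bottom point is adjusted instead: the arc to \<open>Top (i - 1)\<close>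
    gets height c below p.\<close>
  define n where "n = - ((i - 1) * int q)"
  define j where "j = - (n div int p)"
  define c where "c = nat (n mod int p)"
  have c: "int c = n mod int p" "c < p"
    using p_pos by (auto simp: c_def nat_less_iff)
  have "n - n div int p * int p = int c"
    unfolding c(1) by (rule minus_div_mult_eq_mod)
  then have ji: "j * int p - (i - 1) * int q = int c"
    by (simp add: j_def n_def)
  have "coprime q p" using coprime_pq by (simp add: coprime_commute)
  then obtain h where "lowered q p h"
    and "{int c - int q, int c, int c + int q} \<subseteq> h ` {..<q + p}"
    using lowered_column[OF _ q_pos assms c(2)] by blast
  then have low: "lowered p q h" and h: "{int c - int q, int c, int c + int q} \<subseteq> h ` {..<N}"
    by (simp_all only: lowered_commute add.commute[of q p])
  show "arc_variable p q x (arc p q (Top i) (Top (i - 2))) (Jt (- i * int q))"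
    using flip_Top[OF low h ji] arc_variable_lam lam_Top_jump by metis
  have "p \<noteq> q" using coprime_pq assms by auto
  have "Jt (- i * int q) = Jt (- i * int q + j * int p)"
    by (simp only: Jt_periodic_mult)
  also have "- i * int q + j * int p = int c - int q"
    using ji by (simp add: algebra_simps)
  also have "Jt (int c - int q) = (X (int c + int q) + X (int c - int q)) / X (int c)"
    by (simp add: periodic_Jt_def add.commute)
  finally show "Jt (- i * int q) \<in> cluster_variables N (quiver_A p q) x"
    using flat_cluster_variable[OF \<open>p \<noteq> q\<close> low h] by simp
qed

end

theorem lemma4p3:
  fixes p q :: nat and x :: "nat \<Rightarrow> 'a::field_char_0"
  assumes "p \<ge> 1" and "q \<ge> 1" and "coprime p q"
    and "alg_indep (p + q) x"
  shows "(q \<ge> 2 \<longrightarrow> (\<forall>j<q.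
            arc_variable p q x (arc p q (Bot (int j)) (Bot (int j + 2)))
              (periodic_J p q x (int j * int p)) \<and>
            periodic_J p q x (int j * int p) \<in> cluster_variables (p + q) (quiver_A p q) x))
       \<and> (p \<ge> 2 \<longrightarrow> (\<forall>i<p.
            arc_variable p q x (arc p q (Top (int i)) (Top (int i - 2)))
              (periodic_Jt p q x (- int i * int q)) \<and>
            periodic_Jt p q x (- int i * int q) \<in> cluster_variables (p + q) (quiver_A p q) x))"
proof -
  interpret annulus p q x
    using assms by unfold_locales
  show ?thesis
    using Bot_jump Top_jump by blast
qed

end
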